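(* Let $t$ be a PPC term. If $t\to_{PPC}t'$, then $\mathcal T(t)\to_{dB}\mathcal T(t')$.
   Context: **PPC.** Fix a countably infinite set of symbols. Terms: $t::=x\mid\hat x\mid t\,t\mid\lambda_\theta p.s$, where $\theta$ is a list of symbols binding the matchables $\hat x$ ($x\in\theta$) in $p$ and the variables $x$ in $s$. Free variables and matchables: $fv(x)=\{x\}$, $fm(\hat x)=\{x\}$ (empty otherwise); both are unions on applications; $fv(\lambda_\theta p.s)=fv(p)\cup(fv(s)\setminus\theta)$ and $fm(\lambda_\theta p.s)=(fm(p)\setminus\theta)\cup fm(s)$. Terms are taken modulo $\alpha$-conversion. Substitutions are finite partial maps from symbols to terms, acting capture-avoidingly on variable occurrences. A match is a substitution, $\mathtt{fail}$ or $\mathtt{wait}$ (decided if not $\mathtt{wait}$). Data structures are $d::=\hat x\mid d\,t$; matchable forms are $m::=d\mid\lambda_\theta t.t$. $\mu\uplus\mu'$ is $\mathtt{fail}$ if either match is $\mathtt{fail}$; else $\mathtt{wait}$ if either is $\mathtt{wait}$; else $\mathtt{fail}$ if the domains intersect; else the union. Matching $\{p/u\}_\theta$ (first applicable clause): 1. $\{\hat x/u\}_\theta=\{x\mapsto u\}$ if $x\in\theta$; 2. $\{\hat x/\hat x\}_\theta=\{\}$ if $x\notin\theta$; 3. $\{p\,q/t\,u\}_\theta=\{p/t\}_\theta\uplus\{q/u\}_\theta$ if both are matchable forms; 4. $\mathtt{fail}$ if $p,u$ are matchable forms; 5. $\mathtt{wait}$ otherwise. A substitution result whose domain is not exactly $\theta$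 becomes $\mathtt{fail}$. A substitution $\sigma$ applied to $s$ gives $\sigma s$, and $\mathtt{fail}$ applied to any term gives $\lambda_{[x]}\hat x.x$. $\to_{PPC}$ is the contextual closure of $(\lambda_\theta p.s)u\to\{p/u\}_\theta s$ when the match is decided. **PPC_dB.** Terms: $t::=\mathsf v_{i,j}\mid\mathsf m_{i,j}\mid t\,t\mid\lambda_np.s$, with $i,j\ge1$ and $n\in\mathbb N$. Variable increment at depth $k$: $\uparrow^{\mathsf v}_k\mathsf v_{i,j}=\mathsf v_{i+1,j}$ if $i>k$, else unchanged; matchables unchanged; homomorphic on applications; $\uparrow^{\mathsf v}_k(\lambda_np.s)=\lambda_n\uparrow^{\mathsf v}_kp.\uparrow^{\mathsf v}_{k+1}s$. Matchable increment $\uparrow^{\mathsf m}_k$ is symmetric, with $\uparrow^{\mathsf m}_k(\lambda_np.s)=\lambda_n\uparrow^{\mathsf m}_{k+1}p.\uparrow^{\mathsf m}_ks$. $\downarrow^{\mathsf v}_k$ is like $\uparrow^{\mathsf v}_k$ but subtracts $1$. The default depth is $k=0$. Substitution at level $i$, $\{\mathsf v_{i,j}\mapsto u_j\}_{j\in J}$: - maps $\mathsf v_{i,k}$ to $u_k$ ($k\in J$), leaves $\mathsf v_{i',k}$ with $i'\neq i$ and matchables unchanged; - is homomorphic on applications; - maps $\lambda_np.s$ to $\lambda_n(\{\mathsf v_{i,j}\mapsto\uparrow^{\mathsf m}u_j\}p).(\{\mathsf v_{i+1,j}\mapsto\uparrow^{\mathsf v}u_j\}s)$. Data structures are $d::=\mathsf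 m_{i,j}\mid d\,t$; matchable forms are $m::=d\mid\lambda_nt.t$. Matching $\{p/u\}_n$: $\{\mathsf m_{1,j}/u\}_n=\{\mathsf v_{1,j}\mapsto u\}$; $\{\mathsf m_{i+1,j}/\mathsf m_{i,j}\}_n=\{\}$; then the application, $\mathtt{fail}$ and $\mathtt{wait}$ clauses as in PPC. A result whose domain is not $\{\mathsf v_{1,1},\dots,\mathsf v_{1,n}\}$ becomes $\mathtt{fail}$. $\mathtt{fail}$ applied to any term gives $\lambda_1\mathsf m_{1,1}.\mathsf v_{1,1}$. $\to_{dB}$ is the contextual closure of $(\lambda_np.s)u\to\downarrow^{\mathsf v}(\{p/\uparrow^{\mathsf v}u\}_ns)$ when the match is decided. Equality is modulo permutation of the secondary indices bound by the same abstraction. **Translation.** For lists of lists of symbols $V,M$ ($V_{ij}$ is the $j$-th element of the $i$-th list; $\theta++V$ means $[\theta]++V$): - $\mathcal T_{V,M}(x)=\mathsf v_{i,j}$ with $i=\min\{i'\mid x\in V_{i'}\}$ and $j=\min\{j'\mid x=V_{ij'}\}$; - $\mathcal T_{V,M}(\hat x)=\mathsf m_{i,j}$, likewise using $M$; - homomorphic on applications; - $\mathcal T_{V,M}(\lambda_\theta p.s)=\lambda_{|\theta|}\mathcal T_{V,\theta++M}(p).\mathcal T_{\theta++V,M}(s)$. Fixing an enumeration $x_1,x_2,\ldots$ of the symbols, $\mathcal T(t)=\mathcal T_{X,X}(t)$ with $X=[[x_1],\dots,[x_n]]$ and $fv(t)\cup fm(t)\subseteq\{x_1,\dots,x_n\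}$.
   Formalization: A list θ with repeated symbols is never taken to be exactly the domain of a match, so such a match fails; comparing the domain with θ as a set, (λ_[x,x] x̂.x)ŷ → ŷ in PPC is not simulated, since the PPC_dB match with n=2 fails. *)

theory Defs
  imports Main "HOL-Combinatorics.Permutations"
begin

section \<open>Matches\<close>

text \<open>
  Both calculi share the notion of match. A substitution is a partial map; all those produced by
  matching are finite. In PPC the keys are symbols, in the de Bruijn calculus they are secondary
  indices at the outermost level.
\<close>

datatype ('k, 't) match = Subst "'k \<rightharpoonup> 't" | Fail | Wait

fun match_union :: "('k, 't) match \<Rightarrow> ('k, 't) match \<Rightarrow> ('k, 't) match" where
  "match_union Fail _ = Fail"
| "match_union _ Fail = Fail"
| "match_union Wait _ = Wait"
| "match_union _ Wait = Wait"
| "match_union (Subst \<sigma>) (Subst \<tau>) =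
     (if dom \<sigma> \<inter> dom \<tau> = {} then Subst (\<sigma> ++ \<tau>) else Fail)"


section \<open>PPC\<close>

subsection \<open>Terms and alpha-conversion\<close>

datatype (symbols: 'a) pterm =
    Var 'a
  | Mat 'a
  | App "'a pterm" "'a pterm"
  | Lam "'a list" "'a pterm" "'a pterm"

fun fv :: "'a pterm \<Rightarrow> 'a set" where
  "fv (Var x) = {x}"
| "fv (Mat x) = {}"
| "fv (App t u) = fv t \<union> fv u"
| "fv (Lam \<theta> p s) = fv p \<union> (fv s - set \<theta>)"

fun fm :: "'a pterm \<Rightarrow> 'a set" where
  "fm (Var x) = {}"
| "fm (Mat x) = {x}"
| "fm (App t u) = fm t \<union> fm u"
| "fm (Lam \<theta> p s) = (fm p - set \<theta>) \<union> fm s"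

text \<open>
  Replacement of the free variables (resp. matchables) named \<open>x\<close> by \<open>y\<close>. It is only used with
  \<open>y\<close> not occurring at all in the term, so that no capture is possible.
\<close>

fun renV :: "'a \<Rightarrow> 'a \<Rightarrow> 'a pterm \<Rightarrow> 'a pterm" where
  "renV x y (Var z) = Var (if z = x then y else z)"
| "renV x y (Mat z) = Mat z"
| "renV x y (App t u) = App (renV x y t) (renV x y u)"
| "renV x y (Lam \<theta> p s) = Lam \<theta> (renV x y p) (if x \<in> set \<theta> then s else renV x y s)"

fun renM :: "'a \<Rightarrow> 'a \<Rightarrow> 'a pterm \<Rightarrow> 'a pterm" where
  "renM x y (Var z) = Var z"
| "renM x y (Mat z) = Mat (if z = x then y else z)"
| "renM x y (App t u) = App (renM x y t) (renM x y u)"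
| "renM x y (Lam \<theta> p s) = Lam \<theta> (if x \<in> set \<theta> then p else renM x y p) (renM x y s)"

text \<open>
  Alpha-conversion is the congruence generated by renaming one bound symbol to a symbol that does
  not occur (free, bound or in a binder) in the abstraction.
\<close>

inductive alpha :: "'a pterm \<Rightarrow> 'a pterm \<Rightarrow> bool" where
  rename: "x \<in> set \<theta> \<Longrightarrow> y \<notin> symbols (Lam \<theta> p s) \<Longrightarrow>
     alpha (Lam \<theta> p s) (Lam (map (\<lambda>z. if z = x then y else z) \<theta>) (renM x y p) (renV x y s))"
| refl: "alpha t t"
| sym: "alpha t u \<Longrightarrow> alpha u t"
| trans: "alpha t u \<Longrightarrow> alpha u w \<Longrightarrow> alpha t w"
| app: "alpha t t' \<Longrightarrow> alpha u u' \<Longrightarrow> alpha (App t u) (App t' u')"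
| lam: "alpha p p' \<Longrightarrow> alpha s s' \<Longrightarrow> alpha (Lam \<theta> p s) (Lam \<theta> p' s')"

quotient_type 'a ppc = "'a pterm" / alpha
  by (rule equivpI) (auto intro!: reflpI sympI transpI intro: alpha.refl alpha.sym alpha.trans)


subsection \<open>Substitution and matching\<close>

text \<open>
  Capture-avoiding substitution is given as usual: \<open>subst\<close> stops at variables that are rebound,
  and it is only applied to representatives for which \<open>capture_free\<close> holds, i.e. no binder
  captures a variable or a matchable of a term that is actually inserted. Note that \<open>\<theta>\<close> binds
  matchables in \<open>p\<close> and variables in \<open>s\<close>, so that the variables of \<open>p\<close> are not shielded by \<open>\<theta>\<close>.
\<close>

fun subst :: "('a \<rightharpoonup> 'a pterm) \<Rightarrow> 'a pterm \<Rightarrow> 'a pterm" where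
  "subst \<sigma> (Var x) = (case \<sigma> x of Some u \<Rightarrow> u | None \<Rightarrow> Var x)"
| "subst \<sigma> (Mat x) = Mat x"
| "subst \<sigma> (App t u) = App (subst \<sigma> t) (subst \<sigma> u)"
| "subst \<sigma> (Lam \<theta> p s) = Lam \<theta> (subst \<sigma> p) (subst (\<sigma> |` (- set \<theta>)) s)"

fun capture_free :: "('a \<rightharpoonup> 'a pterm) \<Rightarrow> 'a pterm \<Rightarrow> bool" where
  "capture_free \<sigma> (Var x) = True"
| "capture_free \<sigma> (Mat x) = True"
| "capture_free \<sigma> (App t u) = (capture_free \<sigma> t \<and> capture_free \<sigma> u)"
| "capture_free \<sigma> (Lam \<theta> p s) =
     ((\<forall>x u. x \<in> fv p \<and> \<sigma> x = Some u \<longrightarrow> fm u \<inter> set \<theta> = {}) \<and>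
      (\<forall>x u. x \<in> fv s - set \<theta> \<and> \<sigma> x = Some u \<longrightarrow> fv u \<inter> set \<theta> = {}) \<and>
      capture_free \<sigma> p \<and> capture_free (\<sigma> |` (- set \<theta>)) s)"

fun data :: "'a pterm \<Rightarrow> bool" where
  "data (Mat x) = True"
| "data (App t u) = data t"
| "data _ = False"

fun mform :: "'a pterm \<Rightarrow> bool" where
  "mform (Lam \<theta> p s) = True"
| "mform t = data t"

text \<open>Matching before the check on the domain.\<close>

fun pre_match :: "'a list \<Rightarrow> 'a pterm \<Rightarrow> 'a pterm \<Rightarrow> ('a, 'a pterm) match" where
  "pre_match \<theta> (Mat x) u =
     (if x \<in> set \<theta> then Subst [x \<mapsto> u]
      else if u = Mat x then Subst Map.empty
      else if mform u then Fail else Wait)"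
| "pre_match \<theta> (App p q) (App t u) =
     (if mform (App p q) \<and> mform (App t u)
      then match_union (pre_match \<theta> p t) (pre_match \<theta> q u) else Wait)"
| "pre_match \<theta> p u = (if mform p \<and> mform u then Fail else Wait)"

text \<open>
  The domain is compared with the list \<open>\<theta>\<close>, where a list with repetitions is not regarded as
  listing any domain exactly; for lists of pairwise distinct symbols the condition is just
  \<open>dom \<sigma> = set \<theta>\<close>.
\<close>

fun check_dom :: "'a list \<Rightarrow> ('a, 't) match \<Rightarrow> ('a, 't) match" where
  "check_dom \<theta> (Subst \<sigma>) = (if distinct \<theta> \<and> dom \<sigma> = set \<theta> then Subst \<sigma> else Fail)"
| "check_dom \<theta> \<mu> = \<mu>"

definition matching :: "'a list \<Rightarrow> 'a pterm \<Rightarrow> 'a pterm \<Rightarrow> ('a, 'a pterm) match" where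
  "matching \<theta> p u = check_dom \<theta> (pre_match \<theta> p u)"


subsection \<open>Reduction\<close>

inductive pstep :: "'a pterm \<Rightarrow> 'a pterm \<Rightarrow> bool" where
  beta_subst: "matching \<theta> p u = Subst \<sigma> \<Longrightarrow> capture_free \<sigma> s \<Longrightarrow>
     pstep (App (Lam \<theta> p s) u) (subst \<sigma> s)"
| beta_fail: "matching \<theta> p u = Fail \<Longrightarrow>
     pstep (App (Lam \<theta> p s) u) (Lam [x] (Mat x) (Var x))"
| app_left: "pstep t t' \<Longrightarrow> pstep (App t u) (App t' u)"
| app_right: "pstep u u' \<Longrightarrow> pstep (App t u) (App t u')"
| lam_pat: "pstep p p' \<Longrightarrow> pstep (Lam \<theta> p s) (Lam \<theta> p' s)"
| lam_body: "pstep s s' \<Longrightarrow> pstep (Lam \<theta> p s) (Lam \<theta> p s')"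

text \<open>Reduction of alpha-equivalence classes: some representatives reduce.\<close>

definition ppc_red :: "'a ppc \<Rightarrow> 'a ppc \<Rightarrow> bool" (infix "\<rightarrow>\<^sub>P\<^sub>P\<^sub>C" 50) where
  "t \<rightarrow>\<^sub>P\<^sub>P\<^sub>C t' \<longleftrightarrow> (\<exists>r r'. t = abs_ppc r \<and> t' = abs_ppc r' \<and> pstep r r')"


section \<open>The de Bruijn calculus\<close>

subsection \<open>Terms\<close>

text \<open>
  Both indices count from 0 instead of 1: \<open>DVar i j\<close> is the variable with indices \<open>i + 1, j + 1\<close>,
  and likewise for \<open>DMat\<close>. Depths are not shifted, so that the condition \<open>i + 1 > k\<close> of increments
  and decrements reads \<open>k \<le> i\<close>.
\<close>

datatype dterm =
    DVar nat nat
  | DMat nat nat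
  | DApp dterm dterm
  | DLam nat dterm dterm

fun permV :: "nat \<Rightarrow> (nat \<Rightarrow> nat) \<Rightarrow> dterm \<Rightarrow> dterm" where
  "permV k \<pi> (DVar i j) = DVar i (if i = k then \<pi> j else j)"
| "permV k \<pi> (DMat i j) = DMat i j"
| "permV k \<pi> (DApp t u) = DApp (permV k \<pi> t) (permV k \<pi> u)"
| "permV k \<pi> (DLam n p s) = DLam n (permV k \<pi> p) (permV (Suc k) \<pi> s)"

fun permM :: "nat \<Rightarrow> (nat \<Rightarrow> nat) \<Rightarrow> dterm \<Rightarrow> dterm" where
  "permM k \<pi> (DVar i j) = DVar i j"
| "permM k \<pi> (DMat i j) = DMat i (if i = k then \<pi> j else j)"
| "permM k \<pi> (DApp t u) = DApp (permM k \<pi> t) (permM k \<pi> u)"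
| "permM k \<pi> (DLam n p s) = DLam n (permM (Suc k) \<pi> p) (permM k \<pi> s)"

text \<open>
  Equality modulo permutation of the secondary indices bound by the same abstraction.
\<close>

inductive deq :: "dterm \<Rightarrow> dterm \<Rightarrow> bool" where
  permute: "\<pi> permutes {..<n} \<Longrightarrow> deq (DLam n p s) (DLam n (permM 0 \<pi> p) (permV 0 \<pi> s))"
| refl: "deq t t"
| sym: "deq t u \<Longrightarrow> deq u t"
| trans: "deq t u \<Longrightarrow> deq u w \<Longrightarrow> deq t w"
| app: "deq t t' \<Longrightarrow> deq u u' \<Longrightarrow> deq (DApp t u) (DApp t' u')"
| lam: "deq p p' \<Longrightarrow> deq s s' \<Longrightarrow> deq (DLam n p s) (DLam n p' s')"

quotient_type db = dterm / deq
  by (rule equivpI) (auto intro!: reflpI sympI transpI intro: deq.refl deq.sym deq.trans)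


subsection \<open>Increments, substitution and matching\<close>

fun incV :: "nat \<Rightarrow> dterm \<Rightarrow> dterm" where
  "incV k (DVar i j) = DVar (if k \<le> i then i + 1 else i) j"
| "incV k (DMat i j) = DMat i j"
| "incV k (DApp t u) = DApp (incV k t) (incV k u)"
| "incV k (DLam n p s) = DLam n (incV k p) (incV (Suc k) s)"

fun incM :: "nat \<Rightarrow> dterm \<Rightarrow> dterm" where
  "incM k (DVar i j) = DVar i j"
| "incM k (DMat i j) = DMat (if k \<le> i then i + 1 else i) j"
| "incM k (DApp t u) = DApp (incM k t) (incM k u)"
| "incM k (DLam n p s) = DLam n (incM (Suc k) p) (incM k s)"

text \<open>
  The decrement of \<open>DVar 0 j\<close> at depth 0, which is meaningless, leaves it unchanged. It does not
  arise in reductions of terms in which every index \<open>j\<close> bound by a \<open>DLam n\<close> satisfies \<open>j < n\<close>.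
\<close>

fun decV :: "nat \<Rightarrow> dterm \<Rightarrow> dterm" where
  "decV k (DVar i j) = DVar (if k \<le> i then i - 1 else i) j"
| "decV k (DMat i j) = DMat i j"
| "decV k (DApp t u) = DApp (decV k t) (decV k u)"
| "decV k (DLam n p s) = DLam n (decV k p) (decV (Suc k) s)"

text \<open>\<open>dsubst i \<sigma>\<close> substitutes \<open>\<sigma> j\<close> for \<open>DVar i j\<close>.\<close>

fun dsubst :: "nat \<Rightarrow> (nat \<rightharpoonup> dterm) \<Rightarrow> dterm \<Rightarrow> dterm" where
  "dsubst i \<sigma> (DVar i' k) =
     (if i' = i then (case \<sigma> k of Some u \<Rightarrow> u | None \<Rightarrow> DVar i' k) else DVar i' k)"
| "dsubst i \<sigma> (DMat i' k) = DMat i' k"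
| "dsubst i \<sigma> (DApp t u) = DApp (dsubst i \<sigma> t) (dsubst i \<sigma> u)"
| "dsubst i \<sigma> (DLam n p s) =
     DLam n (dsubst i (map_option (incM 0) \<circ> \<sigma>) p)
            (dsubst (Suc i) (map_option (incV 0) \<circ> \<sigma>) s)"

fun ddata :: "dterm \<Rightarrow> bool" where
  "ddata (DMat i j) = True"
| "ddata (DApp t u) = ddata t"
| "ddata _ = False"

fun dmform :: "dterm \<Rightarrow> bool" where
  "dmform (DLam n p s) = True"
| "dmform t = ddata t"

fun dpre_match :: "dterm \<Rightarrow> dterm \<Rightarrow> (nat, dterm) match" where
  "dpre_match (DMat 0 j) u = Subst [j \<mapsto> u]"
| "dpre_match (DMat (Suc i) j) u =
     (if u = DMat i j then Subst Map.empty
      else if dmform u then Fail else Wait)"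
| "dpre_match (DApp p q) (DApp t u) =
     (if dmform (DApp p q) \<and> dmform (DApp t u)
      then match_union (dpre_match p t) (dpre_match q u) else Wait)"
| "dpre_match p u = (if dmform p \<and> dmform u then Fail else Wait)"

fun dcheck_dom :: "nat \<Rightarrow> (nat, 't) match \<Rightarrow> (nat, 't) match" where
  "dcheck_dom n (Subst \<sigma>) = (if dom \<sigma> = {..<n} then Subst \<sigma> else Fail)"
| "dcheck_dom n \<mu> = \<mu>"

definition dmatching :: "nat \<Rightarrow> dterm \<Rightarrow> dterm \<Rightarrow> (nat, dterm) match" where
  "dmatching n p u = dcheck_dom n (dpre_match p u)"


subsection \<open>Reduction\<close>

inductive dstep :: "dterm \<Rightarrow> dterm \<Rightarrow> bool" where
  beta_subst: "dmatching n p (incV 0 u) = Subst \<sigma> \<Longrightarrow>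
     dstep (DApp (DLam n p s) u) (decV 0 (dsubst 0 \<sigma> s))"
| beta_fail: "dmatching n p (incV 0 u) = Fail \<Longrightarrow>
     dstep (DApp (DLam n p s) u) (decV 0 (DLam 1 (DMat 0 0) (DVar 0 0)))"
| app_left: "dstep t t' \<Longrightarrow> dstep (DApp t u) (DApp t' u)"
| app_right: "dstep u u' \<Longrightarrow> dstep (DApp t u) (DApp t u')"
| lam_pat: "dstep p p' \<Longrightarrow> dstep (DLam n p s) (DLam n p' s)"
| lam_body: "dstep s s' \<Longrightarrow> dstep (DLam n p s) (DLam n p s')"

definition db_red :: "db \<Rightarrow> db \<Rightarrow> bool" (infix "\<rightarrow>\<^sub>d\<^sub>B" 50) where
  "t \<rightarrow>\<^sub>d\<^sub>B t' \<longleftrightarrow> (\<exists>r r'. t = abs_db r \<and> t' = abs_db r' \<and> dstep r r')"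


section \<open>Translation\<close>

text \<open>The \<open>j\<close>-th element of the \<open>i\<close>-th list of \<open>W\<close> exists and is \<open>x\<close>.\<close>

definition occurs_at :: "'a list list \<Rightarrow> nat \<Rightarrow> nat \<Rightarrow> 'a \<Rightarrow> bool" where
  "occurs_at W i j x \<longleftrightarrow> i < length W \<and> j < length (W ! i) \<and> W ! i ! j = x"

definition idx1 :: "'a list list \<Rightarrow> 'a \<Rightarrow> nat" where
  "idx1 W x = (LEAST i. \<exists>j. occurs_at W i j x)"

definition idx2 :: "'a list list \<Rightarrow> 'a \<Rightarrow> nat" where
  "idx2 W x = (LEAST j. occurs_at W (idx1 W x) j x)"

fun transl :: "'a list list \<Rightarrow> 'a list list \<Rightarrow> 'a pterm \<Rightarrow> dterm" where
  "transl V M (Var x) = DVar (idx1 V x) (idx2 V x)"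
| "transl V M (Mat x) = DMat (idx1 M x) (idx2 M x)"
| "transl V M (App t u) = DApp (transl V M t) (transl V M u)"
| "transl V M (Lam \<theta> p s) = DLam (length \<theta>) (transl V (\<theta> # M) p) (transl (\<theta> # V) M s)"

definition singletons :: "(nat \<Rightarrow> 'a) \<Rightarrow> nat \<Rightarrow> 'a list list" where
  "singletons e n = map (\<lambda>i. [e i]) [0..<n]"

text \<open>
  For an enumeration \<open>e\<close> of the symbols, the least initial segment covering the free symbols is
  used; by lemma \<open>translate_abs\<close> below, every other covering segment gives the same result.
\<close>

definition transl_top :: "(nat \<Rightarrow> 'a) \<Rightarrow> 'a pterm \<Rightarrow> dterm" where
  "transl_top e t =
     (let X = singletons e (LEAST n. fv t \<union> fm t \<subseteq> e ` {..<n}) in transl X X t)"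


subsection \<open>Independence of the representative\<close>

definition found :: "'a list list \<Rightarrow> 'a \<Rightarrow> bool" where
  "found W x \<longleftrightarrow> (\<exists>i j. occurs_at W i j x)"

definition agree :: "'a list list \<Rightarrow> 'a list list \<Rightarrow> 'a \<Rightarrow> 'a \<Rightarrow> bool" where
  "agree W W' x y \<longleftrightarrow>
     found W x = found W' y \<and> (found W x \<longrightarrow> idx1 W x = idx1 W' y \<and> idx2 W x = idx2 W' y)"

lemma agree_refl: "agree W W x x"
  by (simp add: agree_def)

lemma agree_idx:
  assumes "agree W W' x y"
  shows "idx1 W x = idx1 W' y" "idx2 W x = idx2 W' y"
proof -
  have "idx1 W x = idx1 W' y \<and> idx2 W x = idx2 W' y"
  proof (cases "found W x")
    case False
    then have "\<And>i j. \<not> occurs_at W i j x" "\<And>i j. \<not> occurs_at W' i j y"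
      using assms by (auto simp: agree_def found_def)
    then show ?thesis by (simp add: idx1_def idx2_def)
  qed (use assms in \<open>auto simp: agree_def\<close>)
  then show "idx1 W x = idx1 W' y" "idx2 W x = idx2 W' y" by auto
qed

lemma occurs_at_0: "occurs_at (\<theta> # W) 0 j x \<longleftrightarrow> j < length \<theta> \<and> \<theta> ! j = x"
  by (simp add: occurs_at_def)

lemma occurs_at_Suc: "occurs_at (\<theta> # W) (Suc i) j x \<longleftrightarrow> occurs_at W i j x"
  by (simp add: occurs_at_def)

lemma ex_occurs_at_0: "(\<exists>j. occurs_at (\<theta> # W) 0 j x) \<longleftrightarrow> x \<in> set \<theta>"
  by (auto simp: occurs_at_0 in_set_conv_nth)

lemma found_Cons: "found (\<theta> # W) x \<longleftrightarrow> x \<in> set \<theta> \<or> found W x"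
proof
  assume "found (\<theta> # W) x"
  then obtain i j where ij: "occurs_at (\<theta> # W) i j x" by (auto simp: found_def)
  show "x \<in> set \<theta> \<or> found W x"
  proof (cases i)
    case 0
    then show ?thesis using ij ex_occurs_at_0 by metis
  next
    case (Suc i')
    then show ?thesis using ij by (auto simp: occurs_at_Suc found_def)
  qed
next
  assume "x \<in> set \<theta> \<or> found W x"
  then show "found (\<theta> # W) x"
    unfolding found_def by (metis ex_occurs_at_0 occurs_at_Suc)
qed

lemma idx_Cons_in:
  assumes "x \<in> set \<theta>"
  shows "idx1 (\<theta> # W) x = 0" "idx2 (\<theta> # W) x = (LEAST j. j < length \<theta> \<and> \<theta> ! j = x)"
proof -
  show 1: "idx1 (\<theta> # W) x = 0"
    unfolding idx1_def by (rule Least_eq_0) (simp add: ex_occurs_at_0 assms)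
  show "idx2 (\<theta> # W) x = (LEAST j. j < length \<theta> \<and> \<theta> ! j = x)"
    unfolding idx2_def 1 occurs_at_0 ..
qed

lemma idx_Cons_notin:
  assumes "x \<notin> set \<theta>" "found W x"
  shows "idx1 (\<theta> # W) x = Suc (idx1 W x)" "idx2 (\<theta> # W) x = idx2 W x"
proof -
  obtain i where i: "\<exists>j. occurs_at (\<theta> # W) (Suc i) j x"
    using assms(2) by (auto simp: found_def occurs_at_Suc)
  show 1: "idx1 (\<theta> # W) x = Suc (idx1 W x)"
    unfolding idx1_def using Least_Suc[where P = "\<lambda>i. \<exists>j. occurs_at (\<theta> # W) i j x", OF i] assms(1) ex_occurs_at_0[of \<theta> W x]
    by (simp add: occurs_at_Suc)
  show "idx2 (\<theta> # W) x = idx2 W x"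
    unfolding idx2_def 1 occurs_at_Suc ..
qed

lemma agree_Cons_in:
  assumes "x \<in> set \<theta>" "y \<in> set \<theta>'"
    and "\<And>j. j < length \<theta> \<and> \<theta> ! j = x \<longleftrightarrow> j < length \<theta>' \<and> \<theta>' ! j = y"
  shows "agree (\<theta> # W) (\<theta>' # W') x y"
  using assms by (simp add: agree_def found_Cons idx_Cons_in)

lemma agree_Cons_notin:
  assumes "x \<notin> set \<theta>" "y \<notin> set \<theta>'" "agree W W' x y"
  shows "agree (\<theta> # W) (\<theta>' # W') x y"
  using assms by (auto simp: agree_def found_Cons idx_Cons_notin)

lemma agree_Cons_same:
  assumes "x \<notin> set \<theta> \<Longrightarrow> agree W W' x x"
  shows "agree (\<theta> # W) (\<theta> # W') x x"
  using assms by (cases "x \<in> set \<theta>") (auto intro: agree_Cons_in agree_Cons_notin)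

lemma transl_cong:
  assumes "\<And>z. z \<in> fv t \<Longrightarrow> agree V V' z z" "\<And>z. z \<in> fm t \<Longrightarrow> agree M M' z z"
  shows "transl V M t = transl V' M' t"
  using assms
proof (induction t arbitrary: V V' M M')
  case (Lam \<theta> p s)
  have "transl V (\<theta> # M) p = transl V' (\<theta> # M') p"
    by (rule Lam.IH) (use Lam.prems in \<open>auto intro!: agree_Cons_same\<close>)
  moreover have "transl (\<theta> # V) M s = transl (\<theta> # V') M' s"
    by (rule Lam.IH) (use Lam.prems in \<open>auto intro!: agree_Cons_same\<close>)
  ultimately show ?case by simp
next
  case (App t u)
  show ?case using App.IH[of V V' M M'] App.prems by simp
qed (auto intro: agree_idx)

lemma transl_renM:
  assumes "y \<notin> symbols t"
    and "\<And>z. z \<in> fv t \<Longrightarrow> agree V V' z z"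
    and "\<And>z. z \<in> fm t \<Longrightarrow> agree M M' z (if z = x then y else z)"
  shows "transl V M t = transl V' M' (renM x y t)"
  using assms
proof (induction t arbitrary: V V' M M')
  case (Lam \<theta> p s)
  have p: "transl V (\<theta> # M) p = transl V' (\<theta> # M') (if x \<in> set \<theta> then p else renM x y p)"
  proof (cases "x \<in> set \<theta>")
    case True
    have "transl V (\<theta> # M) p = transl V' (\<theta> # M') p"
    proof (rule transl_cong)
      fix z assume z: "z \<in> fm p"
      show "agree (\<theta> # M) (\<theta> # M') z z"
      proof (rule agree_Cons_same)
        assume nz: "z \<notin> set \<theta>"
        then have "z \<noteq> x" using True by auto
        then show "agree M M' z z" using Lam.prems(3)[of z] z nz by simp
      qed
    qed (use Lam.prems in auto)
    then show ?thesis using True by simp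
  next
    case False
    have "transl V (\<theta> # M) p = transl V' (\<theta> # M') (renM x y p)"
    proof (rule Lam.IH)
      fix z assume z: "z \<in> fm p"
      show "agree (\<theta> # M) (\<theta> # M') z (if z = x then y else z)"
      proof (cases "z \<in> set \<theta>")
        case True
        then show ?thesis using False by (auto intro!: agree_Cons_in)
      next
        case nz: False
        then show ?thesis using Lam.prems(1) Lam.prems(3)[of z] z
          by (intro agree_Cons_notin) auto
      qed
    qed (use Lam.prems in auto)
    then show ?thesis using False by simp
  qed
  have "transl (\<theta> # V) M s = transl (\<theta> # V') M' (renM x y s)"
    by (rule Lam.IH) (use Lam.prems in \<open>auto intro!: agree_Cons_same\<close>)
  with p show ?case by simp
next
  case (App t u)
  show ?case using App.IH[of V V' M M'] App.prems by simp
next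
  case (Mat z)
  show ?case using agree_idx[OF Mat.prems(3)[of z]] by simp
qed (auto intro: agree_idx)

lemma transl_renV:
  assumes "y \<notin> symbols t"
    and "\<And>z. z \<in> fm t \<Longrightarrow> agree M M' z z"
    and "\<And>z. z \<in> fv t \<Longrightarrow> agree V V' z (if z = x then y else z)"
  shows "transl V M t = transl V' M' (renV x y t)"
  using assms
proof (induction t arbitrary: V V' M M')
  case (Lam \<theta> p s)
  have s: "transl (\<theta> # V) M s = transl (\<theta> # V') M' (if x \<in> set \<theta> then s else renV x y s)"
  proof (cases "x \<in> set \<theta>")
    case True
    have "transl (\<theta> # V) M s = transl (\<theta> # V') M' s"
    proof (rule transl_cong)
      fix z assume z: "z \<in> fv s"
      show "agree (\<theta> # V) (\<theta> # V') z z"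
      proof (rule agree_Cons_same)
        assume nz: "z \<notin> set \<theta>"
        then have "z \<noteq> x" using True by auto
        then show "agree V V' z z" using Lam.prems(3)[of z] z nz by simp
      qed
    qed (use Lam.prems in auto)
    then show ?thesis using True by simp
  next
    case False
    have "transl (\<theta> # V) M s = transl (\<theta> # V') M' (renV x y s)"
    proof (rule Lam.IH)
      fix z assume z: "z \<in> fv s"
      show "agree (\<theta> # V) (\<theta> # V') z (if z = x then y else z)"
      proof (cases "z \<in> set \<theta>")
        case True
        then show ?thesis using False by (auto intro!: agree_Cons_in)
      next
        case nz: False
        then show ?thesis using Lam.prems(1) Lam.prems(3)[of z] z
          by (intro agree_Cons_notin) auto
      qed
    qed (use Lam.prems in auto)
    then show ?thesis using False by simp
  qed
  have "transl V (\<theta> # M) p = transl V' (\<theta> # M') (renV x y p)"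
    by (rule Lam.IH) (use Lam.prems in \<open>auto intro!: agree_Cons_same\<close>)
  with s show ?case by simp
next
  case (App t u)
  show ?case using App.IH[of M M' V V'] App.prems by simp
next
  case (Var z)
  show ?case using agree_idx[OF Var.prems(3)[of z]] by simp
qed (auto intro: agree_idx)

lemma agree_Cons_rename:
  assumes "x \<in> set \<theta>" "y \<notin> set \<theta>" "z \<noteq> y"
  shows "agree (\<theta> # W) (map (\<lambda>z. if z = x then y else z) \<theta> # W) z (if z = x then y else z)"
proof (cases "z \<in> set \<theta>")
  case True
  have "(if z = x then y else z) \<in> (\<lambda>z. if z = x then y else z) ` set \<theta>"
    using True by (rule imageI)
  moreover have "j < length \<theta> \<Longrightarrow> \<theta> ! j \<noteq> y" for j
    using assms(2) by (auto simp: in_set_conv_nth)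
  ultimately show ?thesis
    using True assms(3) by (intro agree_Cons_in) (auto split: if_split_asm)
next
  case False
  then show ?thesis using assms by (auto intro!: agree_Cons_notin agree_refl)
qed

lemma fv_symbols: "fv t \<subseteq> symbols t" and fm_symbols: "fm t \<subseteq> symbols t"
  by (induction t) auto

lemma fv_renM: "fv (renM x y t) = fv t"
  by (induction t) auto

lemma fm_renV: "fm (renV x y t) = fm t"
  by (induction t) auto

lemma fm_renM:
  "y \<notin> symbols t \<Longrightarrow> fm (renM x y t) = (\<lambda>z. if z = x then y else z) ` fm t"
proof (induction t)
  case (Lam \<theta> p s)
  have "fm p \<subseteq> symbols p" by (rule fm_symbols)
  with Lam show ?case by (auto split: if_splits)
qed auto

lemma fv_renV:
  "y \<notin> symbols t \<Longrightarrow> fv (renV x y t) = (\<lambda>z. if z = x then y else z) ` fv t"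
proof (induction t)
  case (Lam \<theta> p s)
  have "fv s \<subseteq> symbols s" by (rule fv_symbols)
  with Lam show ?case by (auto split: if_splits)
qed auto

lemma alpha_free: "alpha t u \<Longrightarrow> fv t = fv u \<and> fm t = fm u"
proof (induction rule: alpha.induct)
  case (rename x \<theta> y p s)
  have "fv s \<subseteq> symbols s" "fm p \<subseteq> symbols p" by (rule fv_symbols fm_symbols)+
  then show ?case
    using rename by (auto simp: fv_renM fm_renV fm_renM fv_renV split: if_splits)
qed auto

lemma alpha_transl: "alpha t u \<Longrightarrow> transl V M t = transl V M u"
proof (induction arbitrary: V M rule: alpha.induct)
  case (rename x \<theta> y p s)
  let ?\<theta>' = "map (\<lambda>z. if z = x then y else z) \<theta>"
  have y: "y \<notin> fm p" "y \<notin> fv s" "y \<notin> set \<theta>" "y \<notin> symbols p" "y \<notin> symbols s"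
    using rename fm_symbols[of p] fv_symbols[of s] by auto
  have "transl V (\<theta> # M) p = transl V (?\<theta>' # M) (renM x y p)"
  proof (rule transl_renM[OF y(4) agree_refl])
    fix z assume "z \<in> fm p"
    then show "agree (\<theta> # M) (?\<theta>' # M) z (if z = x then y else z)"
      using rename(1) y by (intro agree_Cons_rename) auto
  qed
  moreover have "transl (\<theta> # V) M s = transl (?\<theta>' # V) M (renV x y s)"
  proof (rule transl_renV[OF y(5) agree_refl])
    fix z assume "z \<in> fv s"
    then show "agree (\<theta> # V) (?\<theta>' # V) z (if z = x then y else z)"
      using rename(1) y by (intro agree_Cons_rename) auto
  qed
  ultimately show ?case by simp
qed auto

lift_definition translate :: "(nat \<Rightarrow> 'a) \<Rightarrow> 'a ppc \<Rightarrow> db" is transl_top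
  by (simp add: transl_top_def alpha_free alpha_transl deq.refl)

lemma transl_singletons:
  assumes "inj e" "fv t \<union> fm t \<subseteq> e ` {..<m}" "fv t \<union> fm t \<subseteq> e ` {..<n}"
  shows "transl (singletons e m) (singletons e m) t = transl (singletons e n) (singletons e n) t"
proof -
  have "agree (singletons e m) (singletons e n) z z"
    if z: "z \<in> e ` {..<m}" "z \<in> e ` {..<n}" for z
  proof -
    obtain k where k: "z = e k" "k < m" "k < n"
      using z assms(1) by (auto dest: injD)
    have *: "occurs_at (singletons e l) i j z \<longleftrightarrow> i = k \<and> j = 0" if "k < l" for l i j
      using k(1) that assms(1) by (auto simp: occurs_at_def singletons_def dest: injD)
    show ?thesis
      unfolding agree_def found_def idx1_def idx2_def by (simp add: *[OF k(2)] *[OF k(3)])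
  qed
  then show ?thesis using assms(2,3) by (intro transl_cong) blast+
qed

lemma translate_abs:
  assumes "inj e" "fv t \<union> fm t \<subseteq> e ` {..<n}"
  shows "translate e (abs_ppc t) = abs_db (transl (singletons e n) (singletons e n) t)"
proof -
  have "fv t \<union> fm t \<subseteq> e ` {..<LEAST n. fv t \<union> fm t \<subseteq> e ` {..<n}}"
    using assms(2) by (rule LeastI)
  then show ?thesis
    using transl_singletons[OF assms(1) _ assms(2)]
    by (simp add: translate.abs_eq transl_top_def Let_def)
qed

end

theory Submission
  imports Defs
begin

text \<open>
  Both calculi compute a match by the same recursion, so the translated redex has the translated
  match, indexed by the positions of the symbols of \<open>\<theta>\<close> in \<open>\<theta>\<close>. This uses that indices
  determine symbols, hence only holds when all free symbols are found in the lists \<open>V\<close> and \<open>M\<close>.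
  Symbols in a repeated \<open>\<theta>\<close> are always translated to their first position, so that a later
  position is never in the domain of the match, and the de Bruijn match fails exactly as the
  PPC one does. Capture-avoidance means that passing under a binder weakens the translation of the
  inserted terms, which is an increment. The simulation is therefore exact on representatives:
  no permutation of secondary indices is needed.
\<close>

section \<open>Indices and increments\<close>

lemma found_Nil [simp]: "\<not> found [] x"
  by (simp add: found_def occurs_at_def)

lemma found_append: "found (W @ A) x \<longleftrightarrow> x \<in> set (concat W) \<or> found A x"
  by (induction W) (auto simp: found_Cons)

text \<open>Here and below, \<open>W\<close> collects the binder lists crossed on the way down to a
  subterm, so \<open>length W\<close> is the current depth. A symbol listed in \<open>W\<close> is
  resolved there, whatever context follows.\<close>

lemma idx_append_in:
  assumes "x \<in> set (concat W)"
  shows "idx1 (W @ A) x < length W" "idx1 (W @ A) x = idx1 (W @ B) x"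
    "idx2 (W @ A) x = idx2 (W @ B) x"
proof -
  have "idx1 (W @ A) x < length W \<and> idx1 (W @ A) x = idx1 (W @ B) x \<and>
    idx2 (W @ A) x = idx2 (W @ B) x"
    using assms
  proof (induction W)
    case (Cons \<theta> W)
    then show ?case
      by (cases "x \<in> set \<theta>") (auto simp: idx_Cons_in idx_Cons_notin found_append)
  qed simp
  then show "idx1 (W @ A) x < length W" "idx1 (W @ A) x = idx1 (W @ B) x"
    "idx2 (W @ A) x = idx2 (W @ B) x" by auto
qed

lemma idx_append_notin:
  assumes "x \<notin> set (concat W)" "found A x"
  shows "idx1 (W @ A) x = length W + idx1 A x" "idx2 (W @ A) x = idx2 A x"
proof -
  have "idx1 (W @ A) x = length W + idx1 A x \<and> idx2 (W @ A) x = idx2 A x"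
    using assms(1)
    by (induction W) (auto simp: idx_Cons_notin found_append assms(2))
  then show "idx1 (W @ A) x = length W + idx1 A x" "idx2 (W @ A) x = idx2 A x" by auto
qed

lemma occurs_at_idx:
  assumes "found W x"
  shows "occurs_at W (idx1 W x) (idx2 W x) x"
proof -
  have "\<exists>j. occurs_at W (idx1 W x) j x"
    unfolding idx1_def by (rule LeastI_ex) (use assms in \<open>auto simp: found_def\<close>)
  then show ?thesis unfolding idx2_def by (rule LeastI_ex)
qed

text \<open>All symbols missing from \<open>W\<close> share the same indices, since
  \<open>LEAST\<close> is then taken over an empty predicate; injectivity therefore concerns found
  symbols only.\<close>

lemma idx_inject:
  assumes "found W x" "found W y" "idx1 W x = idx1 W y" "idx2 W x = idx2 W y"
  shows "x = y"
  using occurs_at_idx[OF assms(1)] occurs_at_idx[OF assms(2)] assms(3,4)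
  by (simp add: occurs_at_def)

text \<open>Inserting \<theta> behind \<open>W\<close> moves by one level just the symbols resolved
  beyond \<open>W\<close>; the hypothesis keeps \<theta> from capturing any of these. Only
  \<open>W = []\<close> is used later, but the induction adds the binders of abstraction bodies to
  \<open>W\<close>.\<close>

lemma transl_weakenV:
  assumes "\<And>x. x \<in> fv t \<Longrightarrow> x \<in> set (concat W) \<or> (x \<notin> set \<theta> \<and> found V x)"
  shows "transl (W @ \<theta> # V) M t = incV (length W) (transl (W @ V) M t)"
  using assms
proof (induction t arbitrary: W M)
  case (Var x)
  show ?case
  proof (cases "x \<in> set (concat W)")
    case True
    then show ?thesis
      using idx_append_in(2,3)[OF True, of "\<theta> # V" V] idx_append_in(1)[OF True, of V] by simp
  next
    case False
    then have "x \<notin> set \<theta>" "found V x" using Var by auto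
    then show ?thesis
      using idx_append_notin[OF False, of V] idx_append_notin[OF False, of "\<theta> # V"]
      by (simp add: idx_Cons_notin found_Cons)
  qed
next
  case (Lam \<theta>' p s)
  have "transl (W @ \<theta> # V) (\<theta>' # M) p = incV (length W) (transl (W @ V) (\<theta>' # M) p)"
    by (rule Lam.IH) (use Lam.prems in auto)
  moreover have "transl ((\<theta>' # W) @ \<theta> # V) M s =
      incV (length (\<theta>' # W)) (transl ((\<theta>' # W) @ V) M s)"
    by (rule Lam.IH) (use Lam.prems in auto)
  ultimately show ?case by simp
qed auto

lemma transl_weakenM:
  assumes "\<And>x. x \<in> fm t \<Longrightarrow> x \<in> set (concat W) \<or> (x \<notin> set \<theta> \<and> found M x)"
  shows "transl V (W @ \<theta> # M) t = incM (length W) (transl V (W @ M) t)"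
  using assms
proof (induction t arbitrary: W V)
  case (Mat x)
  show ?case
  proof (cases "x \<in> set (concat W)")
    case True
    then show ?thesis
      using idx_append_in(2,3)[OF True, of "\<theta> # M" M] idx_append_in(1)[OF True, of M] by simp
  next
    case False
    then have "x \<notin> set \<theta>" "found M x" using Mat by auto
    then show ?thesis
      using idx_append_notin[OF False, of M] idx_append_notin[OF False, of "\<theta> # M"]
      by (simp add: idx_Cons_notin found_Cons)
  qed
next
  case (Lam \<theta>' p s)
  have "transl V ((\<theta>' # W) @ \<theta> # M) p =
      incM (length (\<theta>' # W)) (transl V ((\<theta>' # W) @ M) p)"
    by (rule Lam.IH) (use Lam.prems in auto)
  moreover have "transl (\<theta>' # V) (W @ \<theta> # M) s = incM (length W) (transl (\<theta>' # V) (W @ M) s)"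
    by (rule Lam.IH) (use Lam.prems in auto)
  ultimately show ?case by simp
qed auto

text \<open>The commutation laws move the increment made when a binder is crossed past the one
  already carried by the inserted term. The latter is finally cancelled by the decrement of the beta
  rule, through \<open>decV_incV\<close>.\<close>

lemma incV_incV: "j \<le> k \<Longrightarrow> incV j (incV k t) = incV (Suc k) (incV j t)"
  by (induction t arbitrary: j k) auto

lemma incM_incV: "incM j (incV k t) = incV k (incM j t)"
  by (induction t arbitrary: j k) auto

lemma decV_incV: "decV k (incV k t) = t"
  by (induction t arbitrary: k) auto


section \<open>Substitution\<close>

text \<open>The binder \<theta> of the contracted redex sits at level \<open>length W\<close>, and
  the third hypothesis says that \<sigma> acts exactly on the variables resolved there. For these,
  \<open>decV\<close> undoes the lift of the inserted term. Variables resolved in \<open>W\<close>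
  have smaller levels and stay; those resolved in \<open>V\<close> have larger levels and drop by
  one, as \<theta> disappears.\<close>

lemma transl_subst:
  assumes "capture_free \<sigma> s"
    and "\<And>x. x \<in> fv s \<Longrightarrow> found (W @ \<theta> # V) x"
    and "\<And>x. x \<in> fv s \<Longrightarrow> x \<in> dom \<sigma> \<longleftrightarrow> x \<in> set \<theta> \<and> x \<notin> set (concat W)"
    and "\<And>x u. x \<in> fv s \<Longrightarrow> \<sigma> x = Some u \<Longrightarrow>
      \<delta> (idx2 (\<theta> # V) x) = Some (incV (length W) (transl (W @ V) M u)) \<and>
      (\<forall>y\<in>fv u. found (W @ V) y) \<and> (\<forall>y\<in>fm u. found M y)"
  shows "decV (length W) (dsubst (length W) \<delta> (transl (W @ \<theta> # V) M s)) =
    transl (W @ V) M (subst \<sigma> s)"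
  using assms
proof (induction s arbitrary: \<sigma> \<delta> W M)
  case (Var x)
  note fnd = Var.prems(2)[of x, simplified]
  show ?case
  proof (cases "\<sigma> x")
    case (Some u)
    then have x: "x \<in> set \<theta>" "x \<notin> set (concat W)" using Var.prems(3)[of x] by auto
    then have "idx1 (W @ \<theta> # V) x = length W" "idx2 (W @ \<theta> # V) x = idx2 (\<theta> # V) x"
      using idx_append_notin[OF x(2), of "\<theta> # V"] by (simp_all add: found_Cons idx_Cons_in)
    then show ?thesis using Var.prems(4)[of x u] Some by (simp add: decV_incV)
  next
    case None
    show ?thesis
    proof (cases "x \<in> set (concat W)")
      case True
      then show ?thesis
        using None idx_append_in(2,3)[OF True, of "\<theta> # V" V] idx_append_in(1)[OF True, of V] by simp
    next
      case False
      then have x: "x \<notin> set \<theta>" "found V x"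
        using None Var.prems(3)[of x] fnd by (auto simp: found_append found_Cons)
      then show ?thesis
        using None idx_append_notin[OF False, of V] idx_append_notin[OF False, of "\<theta> # V"]
        by (simp add: idx_Cons_notin found_Cons)
    qed
  qed
next
  case (App t u)
  have "decV (length W) (dsubst (length W) \<delta> (transl (W @ \<theta> # V) M t)) =
    transl (W @ V) M (subst \<sigma> t)"
  proof (rule App.IH(1))
    fix x v assume "x \<in> fv t" "\<sigma> x = Some v"
    then show "\<delta> (idx2 (\<theta> # V) x) = Some (incV (length W) (transl (W @ V) M v)) \<and>
        (\<forall>y\<in>fv v. found (W @ V) y) \<and> (\<forall>y\<in>fm v. found M y)"
      by (intro App.prems(4)) auto
  qed (use App.prems in auto)
  moreover have "decV (length W) (dsubst (length W) \<delta> (transl (W @ \<theta> # V) M u)) =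
    transl (W @ V) M (subst \<sigma> u)"
  proof (rule App.IH(2))
    fix x v assume "x \<in> fv u" "\<sigma> x = Some v"
    then show "\<delta> (idx2 (\<theta> # V) x) = Some (incV (length W) (transl (W @ V) M v)) \<and>
        (\<forall>y\<in>fv v. found (W @ V) y) \<and> (\<forall>y\<in>fm v. found M y)"
      by (intro App.prems(4)) auto
  qed (use App.prems in auto)
  ultimately show ?case by simp
next
  case (Lam \<theta>' p s)
  let ?k = "length W"
  let ?\<tau> = "\<sigma> |` (- set \<theta>')"
  have "decV ?k (dsubst ?k (map_option (incM 0) \<circ> \<delta>) (transl (W @ \<theta> # V) (\<theta>' # M) p)) =
    transl (W @ V) (\<theta>' # M) (subst \<sigma> p)"
  proof (rule Lam.IH(1))
    fix x u assume x: "x \<in> fv p" "\<sigma> x = Some u"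
    then have u: "\<delta> (idx2 (\<theta> # V) x) = Some (incV ?k (transl (W @ V) M u))"
      "\<forall>y\<in>fv u. found (W @ V) y" "\<forall>y\<in>fm u. found M y"
      using Lam.prems(4)[of x u] by auto
    \<comment> \<open>In the pattern the binder catches matchables: by capture-freeness, extending
      \<open>M\<close> by \<theta>' amounts to the \<open>incM 0\<close> that \<open>dsubst\<close>
      applies to the inserted terms.\<close>
    have "fm u \<inter> set \<theta>' = {}" using Lam.prems(1) x by auto
    then have "transl (W @ V) (\<theta>' # M) u = incM 0 (transl (W @ V) M u)"
      using transl_weakenM[of u "[]" \<theta>' M] u(3) by auto
    then show "(map_option (incM 0) \<circ> \<delta>) (idx2 (\<theta> # V) x) =
        Some (incV ?k (transl (W @ V) (\<theta>' # M) u)) \<and>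
      (\<forall>y\<in>fv u. found (W @ V) y) \<and> (\<forall>y\<in>fm u. found (\<theta>' # M) y)"
      using u by (simp add: incM_incV found_Cons)
  qed (use Lam.prems in auto)
  moreover have "decV (length (\<theta>' # W)) (dsubst (length (\<theta>' # W)) (map_option (incV 0) \<circ> \<delta>)
      (transl ((\<theta>' # W) @ \<theta> # V) M s)) = transl ((\<theta>' # W) @ V) M (subst ?\<tau> s)"
  proof (rule Lam.IH(2))
    fix x assume x: "x \<in> fv s"
    show "found ((\<theta>' # W) @ \<theta> # V) x"
      using Lam.prems(2)[of x] x by (auto simp: found_Cons)
    show "x \<in> dom ?\<tau> \<longleftrightarrow> x \<in> set \<theta> \<and> x \<notin> set (concat (\<theta>' # W))"
      using Lam.prems(3)[of x] x by auto
    fix u assume "?\<tau> x = Some u"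
    then have xu: "x \<notin> set \<theta>'" "\<sigma> x = Some u" by (auto simp: restrict_map_def split: if_splits)
    then have u: "\<delta> (idx2 (\<theta> # V) x) = Some (incV ?k (transl (W @ V) M u))"
      "\<forall>y\<in>fv u. found (W @ V) y" "\<forall>y\<in>fm u. found M y"
      using Lam.prems(4)[of x u] x by auto
    \<comment> \<open>In the body the binder catches variables instead, so \<theta>' joins
      \<open>W\<close> and the lift of the inserted term rises to the next depth.\<close>
    have "fv u \<inter> set \<theta>' = {}" using Lam.prems(1) x xu by auto
    then have "transl (\<theta>' # W @ V) M u = incV 0 (transl (W @ V) M u)"
      using transl_weakenV[of u "[]" \<theta>' "W @ V"] u(2) by auto
    then show "(map_option (incV 0) \<circ> \<delta>) (idx2 (\<theta> # V) x) =
        Some (incV (length (\<theta>' # W)) (transl ((\<theta>' # W) @ V) M u)) \<and>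
      (\<forall>y\<in>fv u. found ((\<theta>' # W) @ V) y) \<and> (\<forall>y\<in>fm u. found M y)"
      using u by (simp add: incV_incV found_Cons)
  qed (use Lam.prems in auto)
  ultimately show ?case by simp
qed simp


section \<open>Matching\<close>

lemma ddata_transl [simp]: "ddata (transl V M t) = data t"
  by (induction t) auto

lemma dmform_transl [simp]: "dmform (transl V M t) = mform t"
  by (cases t) auto

lemma ddata_incV [simp]: "ddata (incV k t) = ddata t"
  by (induction t) auto

lemma dmform_incV [simp]: "dmform (incV k t) = dmform t"
  by (cases t) auto

text \<open>\<open>f\<close> will send a symbol to its position in \<theta>, and \<open>F\<close>
  will be translation followed by the lift of the argument. Bounding the domain by \<open>A\<close>
  lets injectivity of \<open>f\<close> be required on \<open>A\<close> only.\<close>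

fun match_rel :: "('a \<Rightarrow> nat) \<Rightarrow> ('a pterm \<Rightarrow> dterm) \<Rightarrow> 'a set \<Rightarrow>
    ('a, 'a pterm) match \<Rightarrow> (nat, dterm) match \<Rightarrow> bool" where
  "match_rel f F A (Subst \<sigma>) (Subst \<delta>) \<longleftrightarrow>
     dom \<sigma> \<subseteq> A \<and> dom \<delta> = f ` dom \<sigma> \<and> (\<forall>x u. \<sigma> x = Some u \<longrightarrow> \<delta> (f x) = Some (F u))"
| "match_rel f F A Fail Fail \<longleftrightarrow> True"
| "match_rel f F A Wait Wait \<longleftrightarrow> True"
| "match_rel f F A _ _ \<longleftrightarrow> False"

text \<open>Injectivity of \<open>f\<close> makes overlapping domains correspond, so both unions
  fail together.\<close>

lemma match_rel_union:
  assumes "inj_on f A" "match_rel f F A \<mu> \<nu>" "match_rel f F A \<mu>' \<nu>'"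
  shows "match_rel f F A (match_union \<mu> \<mu>') (match_union \<nu> \<nu>')"
proof (cases \<mu>; cases \<nu>; cases \<mu>'; cases \<nu>')
  fix \<sigma> \<delta> \<sigma>' \<delta>'
  assume eq: "\<mu> = Subst \<sigma>" "\<nu> = Subst \<delta>" "\<mu>' = Subst \<sigma>'" "\<nu>' = Subst \<delta>'"
  have "f ` dom \<sigma> \<inter> f ` dom \<sigma>' = f ` (dom \<sigma> \<inter> dom \<sigma>')"
    using assms eq by (intro inj_on_image_Int[symmetric]) auto
  then have dis: "dom \<delta> \<inter> dom \<delta>' = {} \<longleftrightarrow> dom \<sigma> \<inter> dom \<sigma>' = {}"
    using assms eq by auto
  have "(\<delta> ++ \<delta>') (f y) = Some (F u)"
    if "dom \<sigma> \<inter> dom \<sigma>' = {}" "(\<sigma> ++ \<sigma>') y = Some u" for y u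
  proof (cases "\<sigma>' y")
    case None
    then have y: "\<sigma> y = Some u" using that(2) by (simp add: map_add_def)
    then have "\<delta> (f y) = Some (F u)" using assms eq by simp
    moreover from this have "\<delta>' (f y) = None" using that(1) dis by blast
    ultimately show ?thesis by (simp add: map_add_def)
  next
    case (Some v)
    then show ?thesis using that(2) assms eq by (simp add: map_add_def)
  qed
  then show ?thesis using assms eq dis by (auto simp: image_Un)
qed (use assms in auto)

lemma pre_match_transl:
  fixes V M :: "'a list list" and \<theta> :: "'a list"
  assumes "\<And>x. x \<in> fm p \<Longrightarrow> found (\<theta> # M) x" "\<And>x. x \<in> fm u \<Longrightarrow> found M x"
  shows "match_rel (idx2 [\<theta>]) (\<lambda>u. incV 0 (transl V M u)) (set \<theta>)
    (pre_match \<theta> p u) (dpre_match (transl V (\<theta> # M) p) (incV 0 (transl V M u)))"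
  using assms
proof (induction \<theta> p u rule: pre_match.induct)
  case (1 \<theta> x u)
  show ?case
  proof (cases "x \<in> set \<theta>")
    case True
    then show ?thesis by (auto simp: idx_Cons_in)
  next
    case False
    then have x: "found M x" using 1 by (auto simp: found_Cons)
    \<comment> \<open>The pattern is translated under one more matchable list than the argument,
      hence \<open>DMat (Suc i) j\<close> is compared with \<open>DMat i j\<close>. Injectivity of
      indices excludes a match between distinct symbols.\<close>
    have "u = Mat x \<longleftrightarrow> incV 0 (transl V M u) = DMat (idx1 M x) (idx2 M x)"
      using 1(2) x by (cases u) (auto dest: idx_inject)
    then show ?thesis using x False by (simp add: idx_Cons_notin)
  qed
next
  case (2 \<theta> p q t u)
  have inj: "inj_on (idx2 [\<theta>]) (set \<theta>)"
    by (rule inj_onI) (rule idx_inject[of "[\<theta>]"], auto simp: found_Cons idx_Cons_in)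
  show ?case
    using 2 by (auto intro!: match_rel_union[OF inj])
qed auto

lemma matching_transl:
  fixes V M :: "'a list list" and \<theta> :: "'a list"
  assumes "\<And>x. x \<in> fm p \<Longrightarrow> found (\<theta> # M) x" "\<And>x. x \<in> fm u \<Longrightarrow> found M x"
  shows "match_rel (idx2 [\<theta>]) (\<lambda>u. incV 0 (transl V M u)) (set \<theta>)
    (matching \<theta> p u) (dmatching (length \<theta>) (transl V (\<theta> # M) p) (incV 0 (transl V M u)))"
proof -
  have lt: "idx2 [\<theta>] x < length \<theta>" "\<theta> ! idx2 [\<theta>] x = x" if "x \<in> set \<theta>" for x
    using occurs_at_idx[of "[\<theta>]" x] that by (auto simp: found_Cons occurs_at_def idx_Cons_in)
  have dom_iff: "distinct \<theta> \<and> D = set \<theta> \<longleftrightarrow> idx2 [\<theta>] ` D = {..<length \<theta>}"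
    if D: "D \<subseteq> set \<theta>" for D
  proof
    assume *: "distinct \<theta> \<and> D = set \<theta>"
    have "j \<in> idx2 [\<theta>] ` set \<theta>" if "j < length \<theta>" for j
    proof
      show "\<theta> ! j \<in> set \<theta>" using that by simp
      then show "j = idx2 [\<theta>] (\<theta> ! j)"
        using lt[of "\<theta> ! j"] * that by (simp add: nth_eq_iff_index_eq)
    qed
    then show "idx2 [\<theta>] ` D = {..<length \<theta>}" using * lt by auto
  next
    assume *: "idx2 [\<theta>] ` D = {..<length \<theta>}"
    have fin: "finite D" using D finite_subset by auto
    \<comment> \<open>The chain \<open>length\<close> \<theta> \<le> \<open>card D\<close> \<le>
      \<open>card (set\<close> \<theta>\<open>)\<close> \<le> \<open>length\<close> \<theta>
      collapses to equalities, which forces both distinctness and \<open>D = set\<close>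
      \<theta>.\<close>
    have "length \<theta> \<le> card D" using card_image_le[OF fin, of "idx2 [\<theta>]"] * by simp
    moreover have "card D \<le> card (set \<theta>)" using D by (simp add: card_mono)
    ultimately have "card (set \<theta>) = length \<theta>" "card D = card (set \<theta>)"
      using card_length[of \<theta>] by auto
    then show "distinct \<theta> \<and> D = set \<theta>" using D card_distinct card_subset_eq by blast
  qed
  show ?thesis
    using pre_match_transl[of p \<theta> M u V, OF assms] dom_iff
    unfolding matching_def dmatching_def
    by (cases "pre_match \<theta> p u";
        cases "dpre_match (transl V (\<theta> # M) p) (incV 0 (transl V M u))") auto
qed


section \<open>Reduction\<close>

text \<open>Every term in a match is a subterm of \<open>u\<close>, reached through applications
  only, so no binder is crossed.\<close>

lemma pre_match_free:
  assumes "pre_match \<theta> p u = Subst \<sigma>" "\<sigma> x = Some v"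
  shows "fv v \<subseteq> fv u \<and> fm v \<subseteq> fm u"
  using assms
proof (induction \<theta> p u arbitrary: \<sigma> x v rule: pre_match.induct)
  case (2 \<theta> p q t u)
  have m: "mform (App p q) \<and> mform (App t u)"
    and un: "match_union (pre_match \<theta> p t) (pre_match \<theta> q u) = Subst \<sigma>"
    using 2(3) by (simp_all split: if_splits)
  obtain \<sigma>1 \<sigma>2 where eq: "pre_match \<theta> p t = Subst \<sigma>1" "pre_match \<theta> q u = Subst \<sigma>2"
    and \<sigma>: "\<sigma> = \<sigma>1 ++ \<sigma>2"
    using un by (cases "pre_match \<theta> p t"; cases "pre_match \<theta> q u") (simp_all split: if_splits)
  from 2(4) consider "\<sigma>1 x = Some v" | "\<sigma>2 x = Some v"
    unfolding \<sigma> by (auto simp: map_add_Some_iff)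
  then show ?case
  proof cases
    case 1
    then show ?thesis using 2(1)[OF m eq(1)] by auto
  next
    case 2
    then show ?thesis using "2.IH"(2)[OF m eq(2)] by auto
  qed
qed (auto split: if_splits)

lemma matching_Subst:
  assumes "matching \<theta> p u = Subst \<sigma>"
  shows "dom \<sigma> = set \<theta>" "\<And>x v. \<sigma> x = Some v \<Longrightarrow> fv v \<subseteq> fv u \<and> fm v \<subseteq> fm u"
proof -
  have *: "pre_match \<theta> p u = Subst \<sigma>" "dom \<sigma> = set \<theta>"
    using assms by (cases "pre_match \<theta> p u"; simp add: matching_def split: if_splits)+
  show "dom \<sigma> = set \<theta>" by (fact *(2))
  show "\<And>x v. \<sigma> x = Some v \<Longrightarrow> fv v \<subseteq> fv u \<and> fm v \<subseteq> fm u"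
    using pre_match_free[OF *(1)] .
qed

text \<open>An upper bound that survives capture, because capture can only remove free
  symbols.\<close>

lemma subst_free:
  assumes "\<And>x v. \<sigma> x = Some v \<Longrightarrow> fv v \<subseteq> A \<and> fm v \<subseteq> B"
  shows "fv (subst \<sigma> s) \<subseteq> (fv s - dom \<sigma>) \<union> A \<and> fm (subst \<sigma> s) \<subseteq> fm s \<union> B"
  using assms
proof (induction s arbitrary: \<sigma>)
  case (Var x)
  then show ?case by (cases "\<sigma> x") auto
next
  case (App t u)
  have "fv (subst \<sigma> t) \<subseteq> (fv t - dom \<sigma>) \<union> A \<and> fm (subst \<sigma> t) \<subseteq> fm t \<union> B"
    by (rule App.IH(1)[OF App.prems])
  moreover have "fv (subst \<sigma> u) \<subseteq> (fv u - dom \<sigma>) \<union> A \<and> fm (subst \<sigma> u) \<subseteq> fm u \<union> B"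
    by (rule App.IH(2)[OF App.prems])
  ultimately show ?case by auto
next
  case (Lam \<theta> p s)
  have "fv (subst \<sigma> p) \<subseteq> (fv p - dom \<sigma>) \<union> A \<and> fm (subst \<sigma> p) \<subseteq> fm p \<union> B"
    by (rule Lam.IH(1)[OF Lam.prems])
  moreover have "fv (subst (\<sigma> |` (- set \<theta>)) s) \<subseteq> (fv s - dom (\<sigma> |` (- set \<theta>))) \<union> A \<and>
      fm (subst (\<sigma> |` (- set \<theta>)) s) \<subseteq> fm s \<union> B"
    by (rule Lam.IH(2)) (use Lam.prems in \<open>auto simp: restrict_map_def split: if_splits\<close>)
  ultimately show ?case by auto
qed simp

text \<open>Allows one common context to serve for a term and its reduct. In a successful beta step
  the variables bound by \<theta> vanish because the match has domain exactly \<open>set\<close>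
  \<theta>.\<close>

lemma pstep_free: "pstep t t' \<Longrightarrow> fv t' \<subseteq> fv t \<and> fm t' \<subseteq> fm t"
proof (induction rule: pstep.induct)
  case (beta_subst \<theta> p u \<sigma> s)
  then show ?case
    using subst_free[of \<sigma> "fv u" "fm u" s] matching_Subst[of \<theta> p u \<sigma>] by auto
qed auto

text \<open>Stated for arbitrary \<open>V\<close> and \<open>M\<close> because a step inside a
  pattern extends \<open>M\<close> and a step inside a body extends \<open>V\<close>.\<close>

lemma pstep_transl:
  assumes "pstep t t'"
    and "\<And>x. x \<in> fv t \<Longrightarrow> found V x" "\<And>x. x \<in> fm t \<Longrightarrow> found M x"
  shows "dstep (transl V M t) (transl V M t')"
  using assms
proof (induction arbitrary: V M rule: pstep.induct)
  case (beta_subst \<theta> p u \<sigma> s)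
  note \<sigma> = matching_Subst[OF beta_subst.hyps(1)]
  have "match_rel (idx2 [\<theta>]) (\<lambda>u. incV 0 (transl V M u)) (set \<theta>)
    (matching \<theta> p u) (dmatching (length \<theta>) (transl V (\<theta> # M) p) (incV 0 (transl V M u)))"
    by (rule matching_transl) (use beta_subst.prems in \<open>auto simp: found_Cons\<close>)
  then obtain \<delta> where
    \<delta>: "dmatching (length \<theta>) (transl V (\<theta> # M) p) (incV 0 (transl V M u)) = Subst \<delta>"
    "\<And>x v. \<sigma> x = Some v \<Longrightarrow> \<delta> (idx2 [\<theta>] x) = Some (incV 0 (transl V M v))"
    using beta_subst.hyps(1)
    by (cases "dmatching (length \<theta>) (transl V (\<theta> # M) p) (incV 0 (transl V M u))") auto
  have "decV 0 (dsubst 0 \<delta> (transl (\<theta> # V) M s)) = transl V M (subst \<sigma> s)"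
  proof (rule transl_subst[where W = "[]", unfolded append_Nil list.size(3), OF beta_subst.hyps(2)])
    fix x v assume x: "\<sigma> x = Some v"
    then have "x \<in> set \<theta>" using \<sigma>(1) by auto
    \<comment> \<open>The match is keyed by positions in \<theta> alone; \<theta> being the
      innermost list, \<open>V\<close> does not affect them.\<close>
    then have "idx2 (\<theta> # V) x = idx2 [\<theta>] x" by (simp add: idx_Cons_in)
    then show "\<delta> (idx2 (\<theta> # V) x) = Some (incV 0 (transl V M v)) \<and>
        (\<forall>y\<in>fv v. found V y) \<and> (\<forall>y\<in>fm v. found M y)"
      using \<delta>(2)[OF x] \<sigma>(2)[OF x] beta_subst.prems by auto
  qed (use beta_subst.prems \<sigma>(1) in \<open>auto simp: found_Cons\<close>)
  then show ?case using dstep.beta_subst[OF \<delta>(1), of "transl (\<theta> # V) M s"] by simp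
next
  case (beta_fail \<theta> p u s x)
  have "match_rel (idx2 [\<theta>]) (\<lambda>u. incV 0 (transl V M u)) (set \<theta>)
    (matching \<theta> p u) (dmatching (length \<theta>) (transl V (\<theta> # M) p) (incV 0 (transl V M u)))"
    by (rule matching_transl) (use beta_fail.prems in \<open>auto simp: found_Cons\<close>)
  then have "dmatching (length \<theta>) (transl V (\<theta> # M) p) (incV 0 (transl V M u)) = Fail"
    using beta_fail.hyps
    by (cases "dmatching (length \<theta>) (transl V (\<theta> # M) p) (incV 0 (transl V M u))") auto
  \<comment> \<open>The identity is closed: \<open>decV 0\<close> fixes it, and its translation does
    not depend on the name of its bound symbol.\<close>
  from dstep.beta_fail[OF this, of "transl (\<theta> # V) M s"] show ?case
    by (simp add: idx_Cons_in)
next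
  case (lam_pat p p' \<theta> s)
  have "dstep (transl V (\<theta> # M) p) (transl V (\<theta> # M) p')"
    by (rule lam_pat.IH) (use lam_pat.prems in \<open>auto simp: found_Cons\<close>)
  then show ?case by (simp add: dstep.lam_pat)
next
  case (lam_body s s' \<theta> p)
  have "dstep (transl (\<theta> # V) M s) (transl (\<theta> # V) M s')"
    by (rule lam_body.IH) (use lam_body.prems in \<open>auto simp: found_Cons\<close>)
  then show ?case by (simp add: dstep.lam_body)
qed (auto intro!: dstep.app_left dstep.app_right)

lemma finite_fv: "finite (fv t)" and finite_fm: "finite (fm t)"
  by (induction t) auto

lemma found_singletons: "found (singletons e n) x \<longleftrightarrow> x \<in> e ` {..<n}"
  by (auto simp: found_def occurs_at_def singletons_def)

theorem theorem5p3:
  fixes x :: "nat \<Rightarrow> 'a" and t t' :: "'a ppc"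
  assumes "bij x"
    and "t \<rightarrow>\<^sub>P\<^sub>P\<^sub>C t'"
  shows "translate x t \<rightarrow>\<^sub>d\<^sub>B translate x t'"
proof -
  obtain r r' where r: "t = abs_ppc r" "t' = abs_ppc r'" "pstep r r'"
    using assms(2) by (auto simp: ppc_red_def)
  have inj: "inj x" using assms(1) by (rule bij_is_inj)
  have fin: "finite (inv x ` (fv r \<union> fm r))" by (simp add: finite_fv finite_fm)
  obtain n where n: "\<forall>i\<in>inv x ` (fv r \<union> fm r). i < n"
    using fin unfolding finite_nat_set_iff_bounded ..
  have sub: "fv r \<union> fm r \<subseteq> x ` {..<n}"
  proof
    fix y assume "y \<in> fv r \<union> fm r"
    then have "inv x y < n" using n by auto
    moreover have "y = x (inv x y)" using assms(1) by (simp add: bij_is_surj surj_f_inv_f)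
    ultimately show "y \<in> x ` {..<n}" by blast
  qed
  \<comment> \<open>\<open>translate\<close> takes the least covering segment of each term, and
    these may differ for \<open>r\<close> and \<open>r'\<close>; \<open>translate_abs\<close>
    replaces both by the common one of length \<open>n\<close>.\<close>
  then have sub': "fv r' \<union> fm r' \<subseteq> x ` {..<n}" using pstep_free[OF r(3)] by blast
  let ?X = "singletons x n"
  have "dstep (transl ?X ?X r) (transl ?X ?X r')"
    by (rule pstep_transl[OF r(3)]) (use sub in \<open>auto simp: found_singletons\<close>)
  then show ?thesis
    unfolding db_red_def r(1,2) translate_abs[OF inj sub] translate_abs[OF inj sub'] by blast
qed

end
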